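(* Let $\mu>0$ and $L>0$, let $f\in \mathcal{F}_{\mu,L}(\mathbb{R}^n)$, let $\mathbf{x}_*$ be a global minimizer of $f$ on $\mathbb{R}^n$, and let $f_* = f(\mathbf{x}_* )$. For any starting point $\mathbf{x}_0\in\mathbb{R}^n$, the iterates $\mathbf{x}_0,\mathbf{x}_1,\mathbf{x}_2,\ldots$ of the gradient descent method with exact line search applied to $f$ satisfy $$f(\mathbf{x}_{i+1}) - f_*\leq \left(\frac{L-\mu}{L+\mu}\right)^2 \left(f(\mathbf{x}_i)-f_*\right) \quad \text{for all } i = 0,1,\ldots$$
   Context: For $L>0$ and $\mu>0$, $\mathcal{F}_{\mu,L}(\mathbb{R}^n)$ denotes the class of $L$-smooth, $\mu$-strongly convex functions on $\mathbb{R}^n$, i.e. continuously differentiable functions $f:\mathbb{R}^n\to\mathbb{R}$ such that (1) $\mathbf{x}\mapsto f(\mathbf{x})-\frac{\mu}{2}\|\mathbf{x}\|^2$ is convex on $\mathbb{R}^n$, where $\|\cdot\|$ is the Euclidean norm; and (2) $\|\nabla f(\mathbf{x}+\Delta\mathbf{x})-\nabla f(\mathbf{x})\|\le L\|\Delta\mathbf{x}\|$ for all $\mathbf{x},\Delta\mathbf{x}\in\mathbb{R}^n$. Gradient descent method with exact line search: given $f\in\mathcal{F}_{\mu,L}(\mathbb{R}^n)$ and $\mathbf{x}_0\in\mathbb{R}^n$, for $i=0,1,\ldots$ choose $\gamma\in\operatorname{argmin}_{\gamma\in\mathbb{R}} f(\mathbf{x}_i-\gamma\nabla f(\mathbf{x}_i))$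 and set $\mathbf{x}_{i+1}=\mathbf{x}_i-\gamma\nabla f(\mathbf{x}_i)$. *)

theory Defs
  imports "HOL-Analysis.Analysis"
begin

text \<open>Meaningful where \<open>f\<close> is differentiable, see \<open>gradient_eqI\<close>; arbitrary elsewhere.\<close>

definition gradient :: "('a::euclidean_space \<Rightarrow> real) \<Rightarrow> 'a \<Rightarrow> 'a" where
  "gradient f x = (THE d. GDERIV f x :> d)"

lemma gradient_eqI:
  assumes "GDERIV f x :> d"
  shows "gradient f x = d"
  unfolding gradient_def
proof (rule the_equality)
  fix e assume "GDERIV f x :> e"
  with assms have "(\<lambda>h. h \<bullet> e) = (\<lambda>h. h \<bullet> d)"
    unfolding gderiv_def by (rule has_derivative_unique[rotated])
  then show "e = d"
    by (metis vector_eq_ldot)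
qed (fact assms)

lemma GDERIV_gradient:
  assumes "f differentiable (at x)"
  shows "GDERIV f x :> gradient f x"
proof -
  obtain D where D: "(f has_derivative D) (at x)"
    using assms unfolding differentiable_def by blast
  have "D = (\<lambda>h. h \<bullet> adjoint D 1)"
    using has_derivative_linear[OF D] by (simp add: fun_eq_iff adjoint_works)
  with D have "GDERIV f x :> adjoint D 1"
    unfolding gderiv_def by simp
  then show ?thesis
    by (simp add: gradient_eqI)
qed

definition smooth_strongly_convex :: "real \<Rightarrow> real \<Rightarrow> (real ^ 'n \<Rightarrow> real) set" where
  "smooth_strongly_convex \<mu> L =
    {f. (\<forall>x. f differentiable (at x)) \<and>
        continuous_on UNIV (gradient f) \<and>
        convex_on UNIV (\<lambda>x. f x - \<mu> / 2 * (norm x)\<^sup>2) \<and>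
        (\<forall>x \<Delta>. norm (gradient f (x + \<Delta>) - gradient f x) \<le> L * norm \<Delta>)}"

text \<open>The step size need not be unique, so the method is a relation: \<open>x\<close> is a possible sequence
  of iterates started at \<open>x0\<close>.\<close>

definition exact_line_search_iterates ::
    "(real ^ 'n \<Rightarrow> real) \<Rightarrow> real ^ 'n \<Rightarrow> (nat \<Rightarrow> real ^ 'n) \<Rightarrow> bool" where
  "exact_line_search_iterates f x0 x \<longleftrightarrow>
    x 0 = x0 \<and>
    (\<forall>i. \<exists>\<gamma>::real. is_arg_min (\<lambda>t. f (x i - t *\<^sub>R gradient f (x i))) (\<lambda>_. True) \<gamma> \<and>
                   x (Suc i) = x i - \<gamma> *\<^sub>R gradient f (x i))"

end

theory Submission
  imports Defs
begin

text \<open>For \<open>\<mu> < L\<close>, any two points satisfy the interpolation inequality obtained by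
  applying cocoercivity of the gradient to the convex function \<open>f - \<mu>/2 \<parallel>\<cdot>\<parallel>\<^sup>2\<close>. It is used for the
  pairs (new iterate, old iterate), (old iterate, minimizer) and (new iterate, minimizer). Exact line
  search makes consecutive gradients orthogonal, and a suitable nonnegative combination of the three
  inequalities leaves the claimed rate plus two squared norms (de Klerk, Glineur and Taylor).
  The case \<open>L \<le> \<mu>\<close> follows by letting a larger Lipschitz constant decrease to \<open>\<mu>\<close>.\<close>

lemma GDERIV_line_deriv:
  assumes "GDERIV f (x + t *\<^sub>R d) :> g"
  shows "((\<lambda>t. f (x + t *\<^sub>R d)) has_real_derivative g \<bullet> d) (at t)"
proof -
  have "((\<lambda>t. x + t *\<^sub>R d) has_derivative (\<lambda>s. s *\<^sub>R d)) (at t)"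
    by (auto intro!: derivative_eq_intros)
  from diff_chain_at[OF this assms[unfolded gderiv_def]]
  have "((\<lambda>t. f (x + t *\<^sub>R d)) has_derivative (\<lambda>s. s * (d \<bullet> g))) (at t)"
    by (simp add: o_def)
  then show ?thesis
    unfolding has_field_derivative_def by (simp add: inner_commute[of d] mult.commute[of _ "g \<bullet> d"])
qed

text \<open>Fermat's rule along a line. It yields both the vanishing gradient at the minimizer and
  the orthogonality of consecutive gradients.\<close>

lemma GDERIV_line_min_orthogonal:
  assumes "GDERIV f (x + t *\<^sub>R d) :> g"
    and "\<And>s. f (x + t *\<^sub>R d) \<le> f (x + s *\<^sub>R d)"
  shows "g \<bullet> d = 0"
  using DERIV_local_min[OF GDERIV_line_deriv[OF assms(1)], of 1] assms(2) by simp

text \<open>Restriction to the line through \<open>x\<close> and \<open>y\<close> reduces this to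
  the tangent inequality for convex functions of one real variable.\<close>

lemma convex_on_above_tangent_GDERIV:
  assumes "convex_on UNIV h" "GDERIV h x :> g"
  shows "h x + g \<bullet> (y - x) \<le> h y"
proof -
  let ?\<phi> = "\<lambda>t::real. h (x + t *\<^sub>R (y - x))"
  have "convex_on UNIV ?\<phi>"
  proof (rule convex_onI)
    fix t s1 s2 :: real assume "0 < t" "t < 1"
    moreover have "x + ((1 - t) *\<^sub>R s1 + t *\<^sub>R s2) *\<^sub>R (y - x) =
        (1 - t) *\<^sub>R (x + s1 *\<^sub>R (y - x)) + t *\<^sub>R (x + s2 *\<^sub>R (y - x))"
      by (simp add: algebra_simps)
    ultimately show "?\<phi> ((1 - t) *\<^sub>R s1 + t *\<^sub>R s2) \<le> (1 - t) * ?\<phi> s1 + t * ?\<phi> s2"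
      using convex_onD[OF assms(1), of t "x + s1 *\<^sub>R (y - x)" "x + s2 *\<^sub>R (y - x)"] by simp
  qed simp
  moreover have "(?\<phi> has_real_derivative g \<bullet> (y - x)) (at 0)"
    by (rule GDERIV_line_deriv) (simp add: assms(2))
  ultimately have "?\<phi> 1 - ?\<phi> 0 \<ge> (g \<bullet> (y - x)) * (1 - 0)"
    by (intro convex_on_imp_above_tangent) (auto intro: has_field_derivative_subset)
  then show ?thesis by simp
qed

text \<open>The descent lemma, without integration: along the segment, \<open>f\<close> minus its
  quadratic model has nonpositive derivative, by Cauchy-Schwarz and the Lipschitz bound.\<close>

lemma Lipschitz_gradient_upper_bound:
  assumes g: "\<And>x. GDERIV f x :> g x"
    and Lip: "\<And>x d. norm (g (x + d) - g x) \<le> L * norm d"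
  shows "f (x + d) \<le> f x + g x \<bullet> d + L / 2 * (norm d)\<^sup>2"
proof -
  let ?\<phi> = "\<lambda>t. f (x + t *\<^sub>R d) - t * (g x \<bullet> d) - L / 2 * (norm d)\<^sup>2 * t\<^sup>2"
  have "?\<phi> 1 \<le> ?\<phi> 0"
  proof (rule DERIV_nonpos_imp_nonincreasing[of 0 1 ?\<phi>])
    fix t :: real assume "0 \<le> t" "t \<le> 1"
    have "(?\<phi> has_real_derivative g (x + t *\<^sub>R d) \<bullet> d - g x \<bullet> d - L * (norm d)\<^sup>2 * t) (at t)"
      by (rule derivative_eq_intros GDERIV_line_deriv g refl | simp)+
    moreover have "g (x + t *\<^sub>R d) \<bullet> d - g x \<bullet> d \<le> L * (norm d)\<^sup>2 * t"
    proof -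
      have "g (x + t *\<^sub>R d) \<bullet> d - g x \<bullet> d \<le> norm (g (x + t *\<^sub>R d) - g x) * norm d"
        by (metis inner_diff_left norm_cauchy_schwarz)
      also have "\<dots> \<le> L * norm (t *\<^sub>R d) * norm d"
        by (intro mult_right_mono Lip) simp
      also have "\<dots> = L * (norm d)\<^sup>2 * t"
        using \<open>0 \<le> t\<close> by (simp add: power2_eq_square)
      finally show ?thesis .
    qed
    ultimately show "\<exists>D. (?\<phi> has_real_derivative D) (at t) \<and> D \<le> 0"
      by (meson diff_le_0_iff_le)
  qed simp
  then show ?thesis by simp
qed

text \<open>The first-order lower bound at \<open>x\<close> is compared with the quadratic upper bound at \<open>y\<close> in the
  point \<open>y - (g y - g x) / M\<close>, which minimises the latter minus the former.\<close>

lemma cocoercive_lower_bound: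
  fixes h :: "'a::real_inner \<Rightarrow> real"
  assumes M: "M > 0"
    and lower: "\<And>x y. h x + g x \<bullet> (y - x) \<le> h y"
    and upper: "\<And>x d. h (x + d) \<le> h x + g x \<bullet> d + M / 2 * (norm d)\<^sup>2"
  shows "(norm (g x - g y))\<^sup>2 \<le> 2 * M * (h y - h x - g x \<bullet> (y - x))"
proof -
  define d where "d = (1 / M) *\<^sub>R (g x - g y)"
  have Md: "g x - g y = M *\<^sub>R d"
    using M by (simp add: d_def)
  have "h x + g x \<bullet> (y + d - x) \<le> h y + g y \<bullet> d + M / 2 * (norm d)\<^sup>2"
    using lower[of x "y + d"] upper[of y d] by linarith
  moreover have "g x \<bullet> (y + d - x) - g y \<bullet> d = g x \<bullet> (y - x) + (g x - g y) \<bullet> d"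
    by (simp add: inner_simps)
  moreover have "(g x - g y) \<bullet> d = M * (norm d)\<^sup>2"
    by (simp add: Md power2_norm_eq_inner)
  ultimately have "M / 2 * (norm d)\<^sup>2 \<le> h y - h x - g x \<bullet> (y - x)"
    by linarith
  then have "2 * M * (M / 2 * (norm d)\<^sup>2) \<le> 2 * M * (h y - h x - g x \<bullet> (y - x))"
    using M by (intro mult_left_mono) auto
  then show ?thesis
    by (simp add: Md power_mult_distrib power2_eq_square mult_ac)
qed

lemma smooth_strongly_convex_interpolation:
  fixes f :: "real ^ 'n \<Rightarrow> real"
  assumes f: "f \<in> smooth_strongly_convex \<mu> L" and "\<mu> < L"
  defines "g \<equiv> gradient f"
  shows "(norm (g x - g y))\<^sup>2 + \<mu> * L * (norm (x - y))\<^sup>2 - 2 * \<mu> * ((g x - g y) \<bullet> (x - y))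
    \<le> 2 * (L - \<mu>) * (f y - f x - g x \<bullet> (y - x))"
proof -
  define h where "h = (\<lambda>x. f x - \<mu> / 2 * (norm x)\<^sup>2)"
  define k where "k = (\<lambda>x. g x - \<mu> *\<^sub>R x)"
  have grad: "GDERIV f x :> g x" for x
    using f by (auto simp: smooth_strongly_convex_def g_def intro: GDERIV_gradient)
  \<comment> \<open>Passing from \<open>f\<close> to \<open>h\<close> lowers the Bregman divergence
    by a quadratic, which turns the upper bound with constant \<open>L\<close> into one with
    \<open>L - \<mu>\<close>.\<close>
  have breg: "h y - h x - k x \<bullet> (y - x) = f y - f x - g x \<bullet> (y - x) - \<mu> / 2 * (norm (x - y))\<^sup>2"
    for x y
    by (simp add: h_def k_def power2_norm_eq_inner inner_simps inner_commute[of y x] algebra_simps)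
  have "GDERIV h x :> k x" for x
  proof -
    have "(h has_derivative (\<lambda>d. d \<bullet> g x - \<mu> / 2 * (x \<bullet> d + d \<bullet> x))) (at x)"
      unfolding h_def power2_norm_eq_inner
      by (intro has_derivative_diff has_derivative_mult_right has_derivative_inner
          grad[unfolded gderiv_def] has_derivative_ident)
    then show ?thesis
      by (simp add: gderiv_def k_def inner_diff_right inner_commute[of x])
  qed
  then have "h x + k x \<bullet> (y - x) \<le> h y" for x y
    using f by (intro convex_on_above_tangent_GDERIV) (auto simp: smooth_strongly_convex_def h_def)
  moreover have "h (x + d) \<le> h x + k x \<bullet> d + (L - \<mu>) / 2 * (norm d)\<^sup>2" for x d
  proof -
    have "f (x + d) \<le> f x + g x \<bullet> d + L / 2 * (norm d)\<^sup>2"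
      using f by (intro Lipschitz_gradient_upper_bound grad)
        (auto simp: smooth_strongly_convex_def g_def)
    then show ?thesis
      using breg[of "x + d" x] by (simp add: left_diff_distrib diff_divide_distrib)
  qed
  ultimately have "(norm (k x - k y))\<^sup>2 \<le> 2 * (L - \<mu>) * (h y - h x - k x \<bullet> (y - x))"
    using \<open>\<mu> < L\<close> by (intro cocoercive_lower_bound) auto
  moreover have "(norm (k x - k y))\<^sup>2
      = (norm (g x - g y))\<^sup>2 - 2 * \<mu> * ((g x - g y) \<bullet> (x - y)) + \<mu>\<^sup>2 * (norm (x - y))\<^sup>2"
  proof -
    have "k x - k y = (g x - g y) - \<mu> *\<^sub>R (x - y)"
      by (simp add: k_def scaleR_diff_right)
    then show ?thesis
      using dot_norm_neg[of "g x - g y" "\<mu> *\<^sub>R (x - y)"] by (simp add: power_mult_distrib)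
  qed
  \<comment> \<open>The coefficient \<open>\<mu> * L\<close> is the sum of
    \<open>(L - \<mu>) * \<mu>\<close>, from \<open>breg\<close>, and
    \<open>\<mu>\<^sup>2\<close>.\<close>
  ultimately show ?thesis
    unfolding breg by (simp add: field_simps power2_eq_square)
qed

text \<open>Here \<open>a\<close>, \<open>b\<close> are the old and new iterates relative to the minimizer, \<open>p\<close>, \<open>q\<close> the gradients
  there, and \<open>F0\<close>, \<open>F1\<close> the function values relative to the minimum. The multipliers of \<open>R1\<close>, \<open>R2\<close>,
  \<open>R3\<close> and the vectors \<open>s\<close>, \<open>u\<close> in the proof come from the dual solution of the semidefinite
  performance estimation problem, with denominators cleared.\<close>

lemma line_search_certificate:
  fixes a b p q :: "'a::real_inner"
  assumes "\<mu> > 0" and "\<mu> < L"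
    and orth: "p \<bullet> q = 0" "q \<bullet> (a - b) = 0"
    and I1: "(norm (q - p))\<^sup>2 + \<mu> * L * (norm (b - a))\<^sup>2 - 2 * \<mu> * ((q - p) \<bullet> (b - a))
        \<le> 2 * (L - \<mu>) * (F0 - F1 - q \<bullet> (a - b))"
    and I2: "(norm p)\<^sup>2 + \<mu> * L * (norm a)\<^sup>2 - 2 * \<mu> * (p \<bullet> a) \<le> 2 * (L - \<mu>) * (p \<bullet> a - F0)"
    and I3: "(norm q)\<^sup>2 + \<mu> * L * (norm b)\<^sup>2 - 2 * \<mu> * (q \<bullet> b) \<le> 2 * (L - \<mu>) * (q \<bullet> b - F1)"
  shows "(L + \<mu>)\<^sup>2 * F1 \<le> (L - \<mu>)\<^sup>2 * F0"
proof -
  \<comment> \<open>Only inner products of the four vectors enter, so the claim becomes a polynomial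
    identity; \<open>orth\<close> identifies \<open>q \<bullet> a\<close> with \<open>qb\<close> and
    makes \<open>p \<bullet> q\<close> vanish.\<close>
  define aa ab bb pa pb qb pp qq where atoms: "aa = a \<bullet> a" "ab = a \<bullet> b" "bb = b \<bullet> b"
    "pa = p \<bullet> a" "pb = p \<bullet> b" "qb = q \<bullet> b" "pp = p \<bullet> p" "qq = q \<bullet> q"
  have inner: "a \<bullet> a = aa" "a \<bullet> b = ab" "b \<bullet> a = ab" "b \<bullet> b = bb" "p \<bullet> a = pa" "a \<bullet> p = pa"
    "p \<bullet> b = pb" "b \<bullet> p = pb" "q \<bullet> b = qb" "b \<bullet> q = qb" "q \<bullet> a = qb" "a \<bullet> q = qb"
    "p \<bullet> p = pp" "q \<bullet> q = qq" "p \<bullet> q = 0" "q \<bullet> p = 0"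
    using orth by (simp_all add: atoms inner_commute inner_diff_right)
  define R1 where "R1 = 2 * (L - \<mu>) * (F0 - F1)
    - (qq + pp + \<mu> * L * (bb - 2 * ab + aa) - 2 * \<mu> * (pa - pb))"
  define R2 where "R2 = 2 * (L - \<mu>) * (pa - F0) - (pp + \<mu> * L * aa - 2 * \<mu> * pa)"
  define R3 where "R3 = 2 * (L - \<mu>) * (qb - F1) - (qq + \<mu> * L * bb - 2 * \<mu> * qb)"
  have R: "R1 \<ge> 0" "R2 \<ge> 0" "R3 \<ge> 0"
    using I1 I2 I3
    by (simp_all add: R1_def R2_def R3_def power2_norm_eq_inner inner_diff_left inner_diff_right
        inner algebra_simps)
  define s where "s = (L * (L + 3 * \<mu>)) *\<^sub>R a - (L * (L + \<mu>)) *\<^sub>R b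
    - (3 * L + \<mu>) *\<^sub>R p - (L + \<mu>) *\<^sub>R q"
  define u where "u = (2 * \<mu> * L * (L + \<mu>)) *\<^sub>R b - (L - \<mu>)\<^sup>2 *\<^sub>R p - (L + \<mu>)\<^sup>2 *\<^sub>R q"
  have s: "s \<bullet> s = (L * (L + 3 * \<mu>))\<^sup>2 * aa + (L * (L + \<mu>))\<^sup>2 * bb + (3 * L + \<mu>)\<^sup>2 * pp
      + (L + \<mu>)\<^sup>2 * qq - 2 * (L * (L + 3 * \<mu>)) * (L * (L + \<mu>)) * ab
      - 2 * (L * (L + 3 * \<mu>)) * (3 * L + \<mu>) * pa - 2 * (L * (L + 3 * \<mu>)) * (L + \<mu>) * qb
      + 2 * (L * (L + \<mu>)) * (3 * L + \<mu>) * pb + 2 * (L * (L + \<mu>)) * (L + \<mu>) * qb"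
    unfolding s_def inner_diff_left inner_diff_right inner_scaleR_left inner_scaleR_right inner
    by (simp add: algebra_simps power2_eq_square power4_eq_xxxx)
  have u: "u \<bullet> u = (2 * \<mu> * L * (L + \<mu>))\<^sup>2 * bb + (L - \<mu>)^4 * pp + (L + \<mu>)^4 * qq
      - 2 * (2 * \<mu> * L * (L + \<mu>)) * (L - \<mu>)\<^sup>2 * pb - 2 * (2 * \<mu> * L * (L + \<mu>)) * (L + \<mu>)\<^sup>2 * qb"
    unfolding u_def inner_diff_left inner_diff_right inner_scaleR_left inner_scaleR_right inner
    by (simp add: algebra_simps power2_eq_square power4_eq_xxxx)
  define A where "A = L * (L + 3 * \<mu>)"
  \<comment> \<open>Completing the square in \<open>a\<close> produces \<open>s\<close>, where
    \<open>a\<close> has coefficient \<open>A\<close>; the remainder is free of \<open>a\<close> and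
    is the single square of \<open>u\<close>.\<close>
  have "A * (2 * (L - \<mu>)) * ((L - \<mu>)\<^sup>2 * F0 - (L + \<mu>)\<^sup>2 * F1)
    = A * ((L - \<mu>) * (L + \<mu>) * R1 + 2 * \<mu> * (L - \<mu>) * R2 + 2 * \<mu> * (L + \<mu>) * R3)
      + (L - \<mu>) * \<mu> * (s \<bullet> s) + u \<bullet> u"
    unfolding A_def R1_def R2_def R3_def s u
    by (simp add: algebra_simps power2_eq_square power4_eq_xxxx)
  also have "\<dots> \<ge> 0"
    using assms(1,2) R by (simp add: A_def)
  finally have "0 \<le> A * (2 * (L - \<mu>)) * ((L - \<mu>)\<^sup>2 * F0 - (L + \<mu>)\<^sup>2 * F1)" .
  moreover have "A * (2 * (L - \<mu>)) > 0"
    using assms(1,2) by (simp add: A_def)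
  ultimately show ?thesis
    by (simp add: zero_le_mult_iff)
qed

text \<open>Enlarging the Lipschitz constant makes the strict inequality \<open>\<mu> < L\<close>
  available in the degenerate case.\<close>

lemma smooth_strongly_convex_mono:
  assumes "f \<in> smooth_strongly_convex \<mu> L" "L \<le> L'"
  shows "f \<in> smooth_strongly_convex \<mu> L'"
proof -
  have "norm (gradient f (x + d) - gradient f x) \<le> L' * norm d" for x d
  proof -
    have "norm (gradient f (x + d) - gradient f x) \<le> L * norm d"
      using assms(1) by (simp add: smooth_strongly_convex_def)
    also have "\<dots> \<le> L' * norm d"
      using assms(2) by (simp add: mult_right_mono)
    finally show ?thesis .
  qed
  then show ?thesis
    using assms(1) by (simp add: smooth_strongly_convex_def)
qed

lemma exact_line_search_step:
  fixes f :: "real ^ 'n \<Rightarrow> real"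
  assumes "\<mu> > 0" "\<mu> < L" and f: "f \<in> smooth_strongly_convex \<mu> L"
    and xstar: "\<And>y. f xstar \<le> f y"
    and y: "y = x - \<gamma> *\<^sub>R gradient f x"
    and \<gamma>: "\<And>t. f y \<le> f (x - t *\<^sub>R gradient f x)"
  shows "f y - f xstar \<le> ((L - \<mu>) / (L + \<mu>))\<^sup>2 * (f x - f xstar)"
proof -
  have grad: "GDERIV f z :> gradient f z" for z
    using f by (auto simp: smooth_strongly_convex_def intro: GDERIV_gradient)
  \<comment> \<open>The line through \<open>xstar\<close> is taken in the direction of the gradient
    itself, so orthogonality says that its norm is zero.\<close>
  have gstar: "gradient f xstar = 0"
    using GDERIV_line_min_orthogonal[of f xstar 0 "gradient f xstar" "gradient f xstar"] grad xstar
    by simp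
  have orth: "gradient f y \<bullet> gradient f x = 0"
    using GDERIV_line_min_orthogonal[of f x "-\<gamma>" "gradient f x" "gradient f y"] grad[of y] \<gamma>[of "- _"]
    by (simp add: y)
  note interp = smooth_strongly_convex_interpolation[OF f \<open>\<mu> < L\<close>]
  have "(L + \<mu>)\<^sup>2 * (f y - f xstar) \<le> (L - \<mu>)\<^sup>2 * (f x - f xstar)"
  proof (rule line_search_certificate[OF \<open>\<mu> > 0\<close> \<open>\<mu> < L\<close>])
    show "gradient f x \<bullet> gradient f y = 0" "gradient f y \<bullet> ((x - xstar) - (y - xstar)) = 0"
      using orth by (simp_all add: y inner_commute)
    have star: "f xstar - f z - gradient f z \<bullet> (xstar - z)
        = gradient f z \<bullet> (z - xstar) - (f z - f xstar)" for z
      by (simp add: inner_diff_right)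
    have star_interp: "(norm (gradient f z))\<^sup>2 + \<mu> * L * (norm (z - xstar))\<^sup>2
        - 2 * \<mu> * (gradient f z \<bullet> (z - xstar))
        \<le> 2 * (L - \<mu>) * (gradient f z \<bullet> (z - xstar) - (f z - f xstar))" for z
      using interp[of z xstar] unfolding star gstar by simp
    show "(norm (gradient f x))\<^sup>2 + \<mu> * L * (norm (x - xstar))\<^sup>2
        - 2 * \<mu> * (gradient f x \<bullet> (x - xstar))
        \<le> 2 * (L - \<mu>) * (gradient f x \<bullet> (x - xstar) - (f x - f xstar))"
      and "(norm (gradient f y))\<^sup>2 + \<mu> * L * (norm (y - xstar))\<^sup>2
        - 2 * \<mu> * (gradient f y \<bullet> (y - xstar))
        \<le> 2 * (L - \<mu>) * (gradient f y \<bullet> (y - xstar) - (f y - f xstar))"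
      by (fact star_interp)+
  qed (use interp[of y x] in simp)
  then show ?thesis
    using assms(1,2) by (simp add: power_divide field_simps)
qed

theorem theorem1p2:
  fixes \<mu> L :: real
    and f :: "real ^ 'n \<Rightarrow> real"
    and xstar x0 :: "real ^ 'n"
    and x :: "nat \<Rightarrow> real ^ 'n"
    and i :: nat
  assumes "\<mu> > 0" and "L > 0"
    and "f \<in> smooth_strongly_convex \<mu> L"
    and "is_arg_min f (\<lambda>_. True) xstar"
    and "exact_line_search_iterates f x0 x"
  shows "f (x (Suc i)) - f xstar \<le> ((L - \<mu>) / (L + \<mu>))\<^sup>2 * (f (x i) - f xstar)"
proof -
  have xstar: "f xstar \<le> f y" for y
    using assms(4) by (auto simp: is_arg_min_def not_less)
  obtain \<gamma> where \<gamma>: "x (Suc i) = x i - \<gamma> *\<^sub>R gradient f (x i)"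
    "\<And>t. f (x (Suc i)) \<le> f (x i - t *\<^sub>R gradient f (x i))"
    using assms(5) unfolding exact_line_search_iterates_def is_arg_min_def
    by (metis not_less)
  \<comment> \<open>Every \<open>M' > M\<close> is an admissible Lipschitz constant exceeding
    \<open>\<mu>\<close>; the rate is continuous in it, so the bound survives the limit from the
    right.\<close>
  define M where "M = max L \<mu>"
  let ?rhs = "\<lambda>M. ((M - \<mu>) / (M + \<mu>))\<^sup>2 * (f (x i) - f xstar)"
  have "f (x (Suc i)) - f xstar \<le> ?rhs M"
  proof (rule tendsto_lowerbound)
    show "(?rhs \<longlongrightarrow> ?rhs M) (at_right M)"
      using assms(1,2) by (intro tendsto_intros) (auto simp: M_def)
    show "\<forall>\<^sub>F M' in at_right M. f (x (Suc i)) - f xstar \<le> ?rhs M'"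
    proof (rule eventually_at_rightI[of M "M + 1"])
      fix M' assume M': "M' \<in> {M<..<M + 1}"
      then have "f \<in> smooth_strongly_convex \<mu> M'"
        by (intro smooth_strongly_convex_mono[OF assms(3)]) (simp add: M_def)
      moreover have "\<mu> < M'"
        using M' by (simp add: M_def)
      ultimately show "f (x (Suc i)) - f xstar \<le> ?rhs M'"
        using exact_line_search_step[OF assms(1) _ _ xstar \<gamma>] by blast
    qed simp
  qed simp
  \<comment> \<open>If \<open>L < \<mu>\<close>, the rate at \<open>M = \<mu>\<close> is zero, while
    the right-hand side is nonnegative; otherwise \<open>M = L\<close>.\<close>
  also have "?rhs M \<le> ?rhs L"
    using xstar[of "x i"] by (auto simp: M_def max_def)
  finally show ?thesis .
qed

end
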